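(* Let $R=\mathbb{Q}[x_1,\ldots,x_7]$, let $I_5=(x_1x_2,x_2x_3,x_3x_4,x_4x_5,x_5x_1)\subset R$ be the edge ideal of the $5$-cycle, let $J_5=(x_1,x_2)\cap(x_2,x_3)\cap(x_3,x_4)\cap(x_4,x_5)\cap(x_5,x_1)\subset R$ be the cover ideal of the $5$-cycle, and let $L_5=x_6I_5+x_7J_5\subset R$. If $i\geq 3$, then $L_5^i$ is integrally closed.
   Context: For an ideal $I$ of a commutative ring $R$, an element $f\in R$ is integral over $I$ if there is an equation $f^k+c_1f^{k-1}+\cdots+c_{k-1}f+c_k=0$ with $c_i\in I^i$. The set $\overline{I}$ of elements integral over $I$ is the integral closure of $I$, and $I$ is integrally closed if $I=\overline{I}$. *)

theory Defs
  imports
    Complex_Main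
    "HOL-Library.Poly_Mapping"
    "HOL-Library.Numeral_Type"
    "HOL-Algebra.Ideal_Product"
begin

text \<open>
  Powers of an ideal are taken in the multiplicative monoid of the library's ring of ideals
  \<^term>\<open>ideals_set R\<close>: multiplication there is the product of ideals \<^term>\<open>ideal_prod R\<close>, and
  the zeroth power is the unit ideal \<^term>\<open>carrier R\<close>.
\<close>

abbreviation ideal_pow :: "('a, 'b) ring_scheme \<Rightarrow> 'a set \<Rightarrow> nat \<Rightarrow> 'a set"
  where "ideal_pow R I n \<equiv> I [^]\<^bsub>ideals_set R\<^esub> n"

text \<open>
  The equation is \<open>f^k + c 1 * f^(k-1) + ... + c (k-1) * f + c k = 0\<close> with \<open>c i\<close> in \<open>I^i\<close>.
\<close>

definition integral_over :: "('a, 'b) ring_scheme \<Rightarrow> 'a set \<Rightarrow> 'a \<Rightarrow> bool"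
  where "integral_over R I f \<longleftrightarrow>
    (\<exists>k::nat. k \<ge> 1 \<and> (\<exists>c::nat \<Rightarrow> 'a.
       (\<forall>i\<in>{1..k}. c i \<in> ideal_pow R I i) \<and>
       f [^]\<^bsub>R\<^esub> k \<oplus>\<^bsub>R\<^esub> (\<Oplus>\<^bsub>R\<^esub>i\<in>{1..k}. c i \<otimes>\<^bsub>R\<^esub> f [^]\<^bsub>R\<^esub> (k - i)) = \<zero>\<^bsub>R\<^esub>))"

definition integral_closure :: "('a, 'b) ring_scheme \<Rightarrow> 'a set \<Rightarrow> 'a set"
  where "integral_closure R I = {f \<in> carrier R. integral_over R I f}"

definition integrally_closed :: "('a, 'b) ring_scheme \<Rightarrow> 'a set \<Rightarrow> bool"
  where "integrally_closed R I \<longleftrightarrow> I = integral_closure R I"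

text \<open>
  Polynomials over the rationals in seven variables: finitely supported maps from exponent vectors
  to coefficients. The variables are indexed by the seven-element type \<open>7\<close>, whose elements are
  the numerals \<open>1, ..., 7\<close> (arithmetic is modulo 7, so the index \<open>7\<close> is the element \<open>0\<close>).
\<close>

type_synonym qpoly7 = "(7 \<Rightarrow>\<^sub>0 nat) \<Rightarrow>\<^sub>0 rat"

definition Q7 :: "qpoly7 ring"
  where "Q7 = \<lparr>carrier = UNIV, mult = (*), one = 1, zero = 0, add = (+)\<rparr>"

definition xvar :: "7 \<Rightarrow> qpoly7"
  where "xvar v = Poly_Mapping.single (Poly_Mapping.single v 1) 1"

lemma cring_Q7: "cring Q7"
proof (rule cringI)
  show "abelian_group Q7"
  proof (rule abelian_groupI)
    fix p :: qpoly7
    have "- p + p = 0" by simp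
    then show "\<exists>q\<in>carrier Q7. q \<oplus>\<^bsub>Q7\<^esub> p = \<zero>\<^bsub>Q7\<^esub>"
      unfolding Q7_def by (metis UNIV_I partial_object.select_convs(1) ring.select_convs(1,2))
  qed (auto simp: Q7_def algebra_simps)
  show "comm_monoid Q7"
    by (rule comm_monoidI) (auto simp: Q7_def algebra_simps)
qed (auto simp: Q7_def algebra_simps)

definition I5 :: "qpoly7 set"
  where "I5 = Idl\<^bsub>Q7\<^esub> {xvar 1 * xvar 2, xvar 2 * xvar 3, xvar 3 * xvar 4, xvar 4 * xvar 5, xvar 5 * xvar 1}"

definition J5 :: "qpoly7 set"
  where "J5 = Idl\<^bsub>Q7\<^esub> {xvar 1, xvar 2} \<inter> Idl\<^bsub>Q7\<^esub> {xvar 2, xvar 3} \<inter> Idl\<^bsub>Q7\<^esub> {xvar 3, xvar 4}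
    \<inter> Idl\<^bsub>Q7\<^esub> {xvar 4, xvar 5} \<inter> Idl\<^bsub>Q7\<^esub> {xvar 5, xvar 1}"

text \<open>
  Here \<^term>\<open>f <#\<^bsub>R\<^esub> I\<close> is the set of all multiples of \<open>f\<close> by elements of \<open>I\<close>, and
  \<open><+>\<close> is the sum of ideals.
\<close>

definition L5 :: "qpoly7 set"
  where "L5 = (xvar 6 <#\<^bsub>Q7\<^esub> I5) <+>\<^bsub>Q7\<^esub> (xvar 7 <#\<^bsub>Q7\<^esub> J5)"

lemma (in cring) ideal_l_coset:
  assumes "ideal I R" and a: "a \<in> carrier R"
  shows "ideal (a <# I) R"
proof -
  interpret I: ideal I R by fact
  show ?thesis
  proof (rule idealI)
    show "ring R" by (rule ring_axioms)
    show "subgroup (a <# I) (add_monoid R)"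
    proof (rule add.subgroupI)
      show "a <# I \<subseteq> carrier R"
        using a I.Icarr by (auto simp: l_coset_def)
      show "a <# I \<noteq> {}"
        using I.zero_closed unfolding l_coset_def by blast
    next
      fix p assume "p \<in> a <# I"
      then obtain q where q: "q \<in> I" "p = a \<otimes> q" by (auto simp: l_coset_def)
      then have "\<ominus> p = a \<otimes> (\<ominus> q)" using a I.Icarr by (simp add: r_minus)
      then show "\<ominus> p \<in> a <# I"
        using q I.a_inv_closed by (auto simp: l_coset_def)
    next
      fix p p' assume "p \<in> a <# I" "p' \<in> a <# I"
      then obtain q q' where q: "q \<in> I" "p = a \<otimes> q" "q' \<in> I" "p' = a \<otimes> q'"
        by (auto simp: l_coset_def)
      then have "p \<oplus> p' = a \<otimes> (q \<oplus> q')" using a I.Icarr by (simp add: r_distr)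
      then show "p \<oplus> p' \<in> a <# I"
        using q I.a_closed by (auto simp: l_coset_def)
    qed
  next
    fix p r assume "p \<in> a <# I" and r: "r \<in> carrier R"
    then obtain q where q: "q \<in> I" "p = a \<otimes> q" by (auto simp: l_coset_def)
    then have eq: "r \<otimes> p = a \<otimes> (r \<otimes> q)" "p \<otimes> r = a \<otimes> (r \<otimes> q)"
      using a r I.Icarr by (auto simp: m_ac)
    show "r \<otimes> p \<in> a <# I" "p \<otimes> r \<in> a <# I"
      unfolding eq using q r I.I_l_closed by (auto simp: l_coset_def)
  qed
qed

lemma ideal_I5: "ideal I5 Q7"
proof -
  interpret cring Q7 by (rule cring_Q7)
  show ?thesis unfolding I5_def by (rule genideal_ideal) (simp add: Q7_def)
qed

lemma ideal_J5: "ideal J5 Q7"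
proof -
  interpret cring Q7 by (rule cring_Q7)
  show ?thesis unfolding J5_def by (intro i_intersect genideal_ideal) (simp_all add: Q7_def)
qed

lemma ideal_L5: "ideal L5 Q7"
proof -
  interpret cring Q7 by (rule cring_Q7)
  show ?thesis unfolding L5_def
    by (intro add_ideals ideal_l_coset ideal_I5 ideal_J5) (simp_all add: Q7_def)
qed

end

theory Submission
  imports Defs
begin

text \<open>
  An additive weight on exponent vectors extends to a valuation, hence it is bounded below on the
  integral closure of \<open>L\<^sub>5\<^sup>i\<close> by \<open>i\<close> times its minimum on \<open>L\<^sub>5\<close>. Eighteen weights suffice:
  if the monomial \<open>x\<^sup>a x\<^sub>6\<^sup>p x\<^sub>7\<^sup>q\<close> satisfies these
  bounds, put \<open>r = min p i\<close> and \<open>s = i - r\<close>. Then \<open>s \<le> q\<close> and \<open>a\<close> lies in \<open>r\<close> times the Newton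
  polyhedron of \<open>I\<^sub>5\<close> plus \<open>s\<close> times that of \<open>J\<^sub>5\<close>. A generator of \<open>I\<^sub>5\<close> or of \<open>J\<^sub>5\<close> can be split
  off within these polyhedra until \<open>r = s = 0\<close>. The only obstruction is \<open>x\<^sub>1 \<cdots> x\<^sub>5\<close> at
  \<open>r = s = 1\<close>, which satisfies all the inequalities without being in \<open>I\<^sub>5 J\<^sub>5\<close>; for \<open>i \<ge> 3\<close> one can
  avoid \<open>r = s = 1\<close>.
\<close>

section \<open>Ideals of the polynomial ring in plain arithmetic\<close>

lemma Q7_simps [simp]:
  "carrier Q7 = UNIV" "x \<otimes>\<^bsub>Q7\<^esub> y = x * y" "x \<oplus>\<^bsub>Q7\<^esub> y = x + y" "\<one>\<^bsub>Q7\<^esub> = 1" "\<zero>\<^bsub>Q7\<^esub> = 0"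
  by (simp_all add: Q7_def)

lemma Q7_pow [simp]: "x [^]\<^bsub>Q7\<^esub> (n::nat) = x ^ n"
  by (induction n) (simp_all add: nat_pow_def mult.commute)

lemma Q7_finsum:
  assumes "finite A"
  shows "finsum Q7 f A = sum f A"
proof -
  interpret cring Q7 by (rule cring_Q7)
  show ?thesis
    using assms by (induction A rule: finite_induct) simp_all
qed

lemma ideal_Q7_iff:
  "ideal I Q7 \<longleftrightarrow> 0 \<in> I \<and> (\<forall>x\<in>I. \<forall>y\<in>I. x + y \<in> I) \<and> (\<forall>x\<in>I. \<forall>r. r * x \<in> I)"
proof
  assume "ideal I Q7"
  then interpret ideal I Q7 .
  show "0 \<in> I \<and> (\<forall>x\<in>I. \<forall>y\<in>I. x + y \<in> I) \<and> (\<forall>x\<in>I. \<forall>r. r * x \<in> I)"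
    using additive_subgroup.zero_closed[OF is_additive_subgroup]
      additive_subgroup.a_closed[OF is_additive_subgroup] I_l_closed by auto
next
  interpret Q: cring Q7 by (rule cring_Q7)
  assume *: "0 \<in> I \<and> (\<forall>x\<in>I. \<forall>y\<in>I. x + y \<in> I) \<and> (\<forall>x\<in>I. \<forall>r. r * x \<in> I)"
  show "ideal I Q7"
  proof (rule idealI)
    show "subgroup I (add_monoid Q7)"
    proof (rule Q.add.subgroupI)
      fix x assume "x \<in> I"
      then have "- 1 * x \<in> I" using * by blast
      moreover have "\<ominus>\<^bsub>Q7\<^esub> x = - x"
        using Q.minus_equality[of "- x" x] by simp
      ultimately show "\<ominus>\<^bsub>Q7\<^esub> x \<in> I" by simp
    qed (use * in auto)
  qed (use * Q.ring_axioms in \<open>auto simp: mult.commute\<close>)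
qed

lemma ideals_set_simps [simp]:
  "\<one>\<^bsub>ideals_set R\<^esub> = carrier R" "I \<otimes>\<^bsub>ideals_set R\<^esub> J = I \<cdot>\<^bsub>R\<^esub> J"
  by (simp_all add: ideals_set_def)

lemma (in cring) ideal_ideal_pow:
  assumes "ideal I R"
  shows "ideal (ideal_pow R I n) R"
  by (induction n) (simp_all add: oneideal ideal_prod_is_ideal assms)

section \<open>Weights as valuations, and integral closure\<close>

definition weight_ge :: "('b::monoid_add \<Rightarrow> nat) \<Rightarrow> nat \<Rightarrow> ('b \<Rightarrow>\<^sub>0 'c::zero) set"
  where "weight_ge \<phi> n = {f. \<forall>m\<in>Poly_Mapping.keys f. n \<le> \<phi> m}"

text \<open>The zero polynomial has no monomials, so it meets every bound, as if its valuation were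
  infinite.\<close>

lemma weight_ge_0 [simp]: "weight_ge \<phi> 0 = UNIV" "0 \<in> weight_ge \<phi> n"
  by (simp_all add: weight_ge_def)

lemma weight_ge_add:
  "f \<in> weight_ge \<phi> n \<Longrightarrow> g \<in> weight_ge \<phi> n \<Longrightarrow> f + g \<in> weight_ge \<phi> n"
  using Poly_Mapping.keys_add[of f g] unfolding weight_ge_def by blast

lemma weight_ge_uminus:
  fixes f :: "'b::monoid_add \<Rightarrow>\<^sub>0 'c::ab_group_add"
  shows "- f \<in> weight_ge \<phi> n \<longleftrightarrow> f \<in> weight_ge \<phi> n"
  by (simp add: weight_ge_def)

lemma weight_ge_sum:
  "(\<And>j. j \<in> A \<Longrightarrow> f j \<in> weight_ge \<phi> n) \<Longrightarrow> sum f A \<in> weight_ge \<phi> n"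
  by (induction A rule: infinite_finite_induct) (auto intro: weight_ge_add)

lemma weight_ge_mono: "f \<in> weight_ge \<phi> n \<Longrightarrow> m \<le> n \<Longrightarrow> f \<in> weight_ge \<phi> m"
  unfolding weight_ge_def by force

text \<open>The linear order on exponents makes the polynomial ring over a domain free of zero
  divisors.\<close>

locale weight =
  fixes \<phi> :: "'b::{ordered_cancel_comm_monoid_add, linorder} \<Rightarrow> nat"
  assumes weight_add: "\<phi> (x + y) = \<phi> x + \<phi> y"
begin

lemma weight_zero: "\<phi> 0 = 0"
  using weight_add[of 0 0] by simp

lemma weight_ge_mult:
  fixes f g :: "'b \<Rightarrow>\<^sub>0 'c::semiring_0"
  assumes "f \<in> weight_ge \<phi> a" "g \<in> weight_ge \<phi> b"
  shows "f * g \<in> weight_ge \<phi> (a + b)"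
  using keys_mult[of f g] assms unfolding weight_ge_def
  by (fastforce simp: weight_add intro: add_mono)

lemma weight_ge_power:
  fixes f :: "'b \<Rightarrow>\<^sub>0 'c::semiring_1"
  assumes "f \<in> weight_ge \<phi> a"
  shows "f ^ k \<in> weight_ge \<phi> (k * a)"
  by (induction k) (simp_all add: weight_ge_mult assms)

text \<open>Meant for the lowest form of a polynomial: its powers stay in a single weight, so a
  strictly larger lower bound forces them to vanish.\<close>

lemma weight_eq_power:
  fixes f :: "'b \<Rightarrow>\<^sub>0 'c::semiring_1"
  assumes "\<And>m. m \<in> Poly_Mapping.keys f \<Longrightarrow> \<phi> m = a"
  shows "m \<in> Poly_Mapping.keys (f ^ k) \<Longrightarrow> \<phi> m = k * a"
proof (induction k arbitrary: m)
  case 0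
  then show ?case by (auto simp: weight_zero split: if_splits)
next
  case (Suc k)
  then show ?case
    using keys_mult[of f "f ^ k"] assms by (fastforce simp: weight_add)
qed

end

text \<open>
  Comparing lowest weight forms shows that an additive weight cannot drop on an integral element:
  the lowest form of \<open>f ^ k\<close> is the \<open>k\<close>-th power of the lowest form of \<open>f\<close>, as there are no zero
  divisors.
\<close>

lemma (in weight) weight_ge_integral:
  fixes f :: "'b \<Rightarrow>\<^sub>0 'c::idom"
  assumes c: "\<And>j. j \<in> {1..k} \<Longrightarrow> c j \<in> weight_ge \<phi> (j * d)"
    and eq: "f ^ k + (\<Sum>j\<in>{1..k}. c j * f ^ (k - j)) = 0"
  shows "f \<in> weight_ge \<phi> d"
proof (rule ccontr)
  assume "f \<notin> weight_ge \<phi> d"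
  then obtain m where m: "m \<in> Poly_Mapping.keys f" "\<phi> m < d"
    by (auto simp: weight_ge_def not_le)
  define a where "a = (LEAST n. n \<in> \<phi> ` Poly_Mapping.keys f)"
  have "a \<in> \<phi> ` Poly_Mapping.keys f"
    unfolding a_def by (rule LeastI[of _ "\<phi> m"]) (use m in auto)
  then obtain m0 where m0: "m0 \<in> Poly_Mapping.keys f" "\<phi> m0 = a" by auto
  have a_le: "a \<le> \<phi> m'" if "m' \<in> Poly_Mapping.keys f" for m'
    unfolding a_def by (rule Least_le) (use that in auto)
  have "a < d" using a_le[OF m(1)] m(2) by simp
  have fa: "f \<in> weight_ge \<phi> a" using a_le by (simp add: weight_ge_def)
  \<comment> \<open>The lowest form of \<open>f\<close>.\<close>
  define g where "g = Poly_Mapping.mapp (\<lambda>m z. z when \<phi> m = a) f"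
  have lookup_g: "Poly_Mapping.lookup g m' = (Poly_Mapping.lookup f m' when \<phi> m' = a)" for m'
    by (auto simp: g_def lookup_mapp when_def in_keys_iff)
  have g_keys: "\<phi> m' = a" if "m' \<in> Poly_Mapping.keys g" for m'
    using that by (auto simp: in_keys_iff lookup_g when_def split: if_splits)
  have ga: "g \<in> weight_ge \<phi> a" using g_keys by (simp add: weight_ge_def)
  have fg: "f - g \<in> weight_ge \<phi> (Suc a)"
    unfolding weight_ge_def
  proof safe
    fix m' assume *: "m' \<in> Poly_Mapping.keys (f - g)"
    then have "m' \<in> Poly_Mapping.keys f" "\<phi> m' \<noteq> a"
      by (auto simp: in_keys_iff lookup_minus lookup_g when_def split: if_splits)
    then show "Suc a \<le> \<phi> m'" using a_le[of m'] by simp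
  qed
  \<comment> \<open>Taking lowest forms commutes with powers up to terms of higher weight; a
    telescoping identity drives the induction.\<close>
  have diff: "f ^ n - g ^ n \<in> weight_ge \<phi> (Suc (n * a))" for n
  proof (induction n)
    case (Suc n)
    have "f ^ Suc n - g ^ Suc n = f * (f ^ n - g ^ n) + (f - g) * g ^ n"
      by (simp add: algebra_simps)
    moreover have "f * (f ^ n - g ^ n) \<in> weight_ge \<phi> (Suc (Suc n * a))"
      using weight_ge_mult[OF fa Suc.IH] by simp
    moreover have "(f - g) * g ^ n \<in> weight_ge \<phi> (Suc (Suc n * a))"
      using weight_ge_mult[OF fg weight_ge_power[OF ga, of n]] by simp
    ultimately show ?case by (simp add: weight_ge_add)
  qed simp
  have "c j * f ^ (k - j) \<in> weight_ge \<phi> (Suc (k * a))" if j: "j \<in> {1..k}" for j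
  proof -
    \<comment> \<open>As \<open>j\<close> is positive, \<open>a < d\<close> gains at least one unit
      of weight: every other term of the equation lies strictly above \<open>k * a\<close>.\<close>
    have "j * a < j * d" using j \<open>a < d\<close> by (intro mult_strict_left_mono) auto
    moreover have "k * a = j * a + (k - j) * a"
      using j by (simp flip: add_mult_distrib)
    ultimately have "Suc (k * a) \<le> j * d + (k - j) * a" by linarith
    moreover have "c j * f ^ (k - j) \<in> weight_ge \<phi> (j * d + (k - j) * a)"
      by (intro weight_ge_mult weight_ge_power c j fa)
    ultimately show ?thesis using weight_ge_mono by blast
  qed
  then have "(\<Sum>j\<in>{1..k}. c j * f ^ (k - j)) \<in> weight_ge \<phi> (Suc (k * a))"
    by (rule weight_ge_sum)
  moreover have "f ^ k = - (\<Sum>j\<in>{1..k}. c j * f ^ (k - j))"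
    using eq by (simp add: eq_neg_iff_add_eq_0)
  ultimately have "f ^ k \<in> weight_ge \<phi> (Suc (k * a))"
    by (simp add: weight_ge_uminus)
  moreover have "- (f ^ k - g ^ k) \<in> weight_ge \<phi> (Suc (k * a))"
    using diff[of k] by (simp only: weight_ge_uminus)
  ultimately have "f ^ k + - (f ^ k - g ^ k) \<in> weight_ge \<phi> (Suc (k * a))"
    by (rule weight_ge_add)
  then have "g ^ k \<in> weight_ge \<phi> (Suc (k * a))" by simp
  then have "Poly_Mapping.keys (g ^ k) = {}"
    using weight_eq_power[of g a _ k] g_keys by (fastforce simp: weight_ge_def)
  then have "g ^ k = 0" by simp
  then have "g = 0" by simp
  moreover have "m0 \<in> Poly_Mapping.keys g"
    using m0 by (simp add: in_keys_iff lookup_g)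
  ultimately show False by simp
qed

lemma weight_ge_ideal_pow:
  assumes "weight \<phi>" "I \<subseteq> weight_ge \<phi> d"
  shows "ideal_pow Q7 I n \<subseteq> weight_ge \<phi> (n * d)"
proof (induction n)
  case (Suc n)
  show ?case
  proof
    fix f assume "f \<in> ideal_pow Q7 I (Suc n)"
    then have "f \<in> ideal_pow Q7 I n \<cdot>\<^bsub>Q7\<^esub> I" by simp
    then show "f \<in> weight_ge \<phi> (Suc n * d)"
    proof induction
      case (prod p q)
      then have "p * q \<in> weight_ge \<phi> (n * d + d)"
        using Suc.IH assms by (intro weight.weight_ge_mult) auto
      then show ?case by (simp add: add.commute)
    qed (simp add: weight_ge_add)
  qed
qed simp

text \<open>The coefficients lie in powers of a power of \<open>I\<close>, so the bound for ideal
  powers is applied twice.\<close>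

lemma integral_closure_weight_ge:
  assumes \<phi>: "weight \<phi>" and I: "I \<subseteq> weight_ge \<phi> d"
    and f: "f \<in> integral_closure Q7 (ideal_pow Q7 I i)"
  shows "f \<in> weight_ge \<phi> (i * d)"
proof -
  obtain k c where c: "\<forall>j\<in>{1..k}. c j \<in> ideal_pow Q7 (ideal_pow Q7 I i) j"
    and "f [^]\<^bsub>Q7\<^esub> k \<oplus>\<^bsub>Q7\<^esub> (\<Oplus>\<^bsub>Q7\<^esub>j\<in>{1..k}. c j \<otimes>\<^bsub>Q7\<^esub> f [^]\<^bsub>Q7\<^esub> (k - j)) = \<zero>\<^bsub>Q7\<^esub>"
    using f unfolding integral_closure_def integral_over_def mem_Collect_eq by (elim conjE exE)
  then have eq: "f ^ k + (\<Sum>j\<in>{1..k}. c j * f ^ (k - j)) = 0"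
    by (simp add: Q7_finsum)
  show ?thesis
  proof (rule weight.weight_ge_integral[OF \<phi> _ eq])
    fix j assume "j \<in> {1..k}"
    then show "c j \<in> weight_ge \<phi> (j * (i * d))"
      using c weight_ge_ideal_pow[OF \<phi> weight_ge_ideal_pow[OF \<phi> I]] by blast
  qed
qed

lemma subset_integral_closure:
  assumes "ideal I Q7"
  shows "I \<subseteq> integral_closure Q7 I"
proof
  interpret cring Q7 by (rule cring_Q7)
  fix f assume f: "f \<in> I"
  have "- 1 * f \<in> I"
    using assms f unfolding ideal_Q7_iff by blast
  \<comment> \<open>The first power unfolds to the product of the unit ideal with \<open>I\<close>,
    hence the factor 1. The equation has degree one, with coefficient \<open>- f\<close>.\<close>
  then have "1 * (- 1 * f) \<in> carrier Q7 \<cdot>\<^bsub>Q7\<^esub> I"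
    using ideal_prod.prod[of 1 "carrier Q7" "- 1 * f" I Q7] by simp
  then have "\<exists>c. (\<forall>i\<in>{1..1}. c i \<in> ideal_pow Q7 I i) \<and>
       f [^]\<^bsub>Q7\<^esub> (1::nat) \<oplus>\<^bsub>Q7\<^esub> (\<Oplus>\<^bsub>Q7\<^esub>i\<in>{1..1}. c i \<otimes>\<^bsub>Q7\<^esub> f [^]\<^bsub>Q7\<^esub> (1 - i)) = \<zero>\<^bsub>Q7\<^esub>"
    by (intro exI[of _ "\<lambda>_. - f"]) (simp add: Q7_finsum)
  then show "f \<in> integral_closure Q7 I"
    unfolding integral_closure_def integral_over_def by fastforce
qed

section \<open>Monomial ideals and the generators of \<open>L5\<close>\<close>

lemma ideal_monomials_upclosed:
  assumes "\<And>m n. Q m \<Longrightarrow> Q (n + m)"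
  shows "ideal {f. \<forall>m\<in>Poly_Mapping.keys f. Q m} Q7"
  unfolding ideal_Q7_iff
proof safe
  fix f g :: qpoly7 and m
  assume "\<forall>m\<in>Poly_Mapping.keys f. Q m" "\<forall>m\<in>Poly_Mapping.keys g. Q m" "m \<in> Poly_Mapping.keys (f + g)"
  then show "Q m" using Poly_Mapping.keys_add[of f g] by blast
next
  fix f g :: qpoly7 and m
  assume "\<forall>m\<in>Poly_Mapping.keys f. Q m" "m \<in> Poly_Mapping.keys (g * f)"
  then show "Q m" using keys_mult[of g f] assms by blast
qed simp

text \<open>By minimality of the generated ideal: an upward closed condition on exponents cuts out
  an ideal, and this one contains \<open>S\<close>.\<close>

lemma genideal_monomials_upclosed:
  assumes "\<And>m n. Q m \<Longrightarrow> Q (n + m)"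
    and "\<And>g m. g \<in> S \<Longrightarrow> m \<in> Poly_Mapping.keys g \<Longrightarrow> Q m"
    and "f \<in> Idl\<^bsub>Q7\<^esub> S" "m \<in> Poly_Mapping.keys f"
  shows "Q m"
proof -
  interpret cring Q7 by (rule cring_Q7)
  have "Idl\<^bsub>Q7\<^esub> S \<subseteq> {f. \<forall>m\<in>Poly_Mapping.keys f. Q m}"
    by (rule genideal_minimal[OF ideal_monomials_upclosed]) (use assms in auto)
  then show ?thesis using assms by blast
qed

lemma exhaust_7:
  fixes v :: 7
  shows "v = 1 \<or> v = 2 \<or> v = 3 \<or> v = 4 \<or> v = 5 \<or> v = 6 \<or> v = 7"
proof (induct v)
  case (of_int z)
  then have "z = 0 \<or> z = 1 \<or> z = 2 \<or> z = 3 \<or> z = 4 \<or> z = 5 \<or> z = 6" by simp arith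
  then show ?case by auto
qed

lemma I5_keys:
  assumes "f \<in> I5" "m \<in> Poly_Mapping.keys f"
  shows "(\<exists>(u, v) \<in> {(1, 2), (2, 3), (3, 4), (4, 5), (5, 1)}.
    1 \<le> Poly_Mapping.lookup m u \<and> 1 \<le> Poly_Mapping.lookup m v)"
  by (rule genideal_monomials_upclosed[OF _ _ assms(1)[unfolded I5_def] assms(2)])
    (auto simp: xvar_def mult_single lookup_add lookup_single)

text \<open>Each prime of the intersection contributes one edge; together they say that the support
  of \<open>m\<close> is a vertex cover of the 5-cycle.\<close>

lemma J5_keys:
  assumes "f \<in> J5" "m \<in> Poly_Mapping.keys f"
  shows "\<forall>(u, v) \<in> {(1, 2), (2, 3), (3, 4), (4, 5), (5, 1)}.
    1 \<le> Poly_Mapping.lookup m u + Poly_Mapping.lookup m v"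
proof -
  have "1 \<le> Poly_Mapping.lookup m u + Poly_Mapping.lookup m v" if "f \<in> Idl\<^bsub>Q7\<^esub> {xvar u, xvar v}" for u v
    by (rule genideal_monomials_upclosed[OF _ _ that assms(2)])
      (auto simp: xvar_def lookup_add lookup_single)
  then show ?thesis using assms(1) unfolding J5_def by blast
qed

lemma xvar_mult_keys:
  assumes "m \<in> Poly_Mapping.keys (xvar v * f)"
  obtains m' where "m' \<in> Poly_Mapping.keys f" "m = Poly_Mapping.single v 1 + m'"
  using assms keys_mult[of "xvar v" f] unfolding xvar_def by auto

lemma L5_iff: "f \<in> L5 \<longleftrightarrow> (\<exists>u\<in>I5. \<exists>v\<in>J5. f = xvar 6 * u + xvar 7 * v)"
  unfolding L5_def set_add_def' l_coset_def by auto

lemma L5_keys: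
  fixes m :: "7 \<Rightarrow>\<^sub>0 nat"
  defines "x \<equiv> Poly_Mapping.lookup m"
  assumes f: "f \<in> L5" and m: "m \<in> Poly_Mapping.keys f"
  shows "1 \<le> x 6 \<and> (1 \<le> x 1 \<and> 1 \<le> x 2 \<or> 1 \<le> x 2 \<and> 1 \<le> x 3 \<or> 1 \<le> x 3 \<and> 1 \<le> x 4 \<or>
      1 \<le> x 4 \<and> 1 \<le> x 5 \<or> 1 \<le> x 5 \<and> 1 \<le> x 1) \<or>
    1 \<le> x 7 \<and> 1 \<le> x 1 + x 2 \<and> 1 \<le> x 2 + x 3 \<and> 1 \<le> x 3 + x 4 \<and> 1 \<le> x 4 + x 5 \<and> 1 \<le> x 5 + x 1"
proof -
  obtain u v where uv: "u \<in> I5" "v \<in> J5" "f = xvar 6 * u + xvar 7 * v"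
    using f L5_iff by blast
  then consider "m \<in> Poly_Mapping.keys (xvar 6 * u)" | "m \<in> Poly_Mapping.keys (xvar 7 * v)"
    using m Poly_Mapping.keys_add[of "xvar 6 * u" "xvar 7 * v"] by blast
  then show ?thesis
  proof cases
    case 1
    then obtain m' where "m' \<in> Poly_Mapping.keys u" "m = Poly_Mapping.single 6 1 + m'"
      by (rule xvar_mult_keys)
    then show ?thesis using I5_keys[OF uv(1)]
      by (auto simp: x_def lookup_add lookup_single)
  next
    case 2
    then obtain m' where "m' \<in> Poly_Mapping.keys v" "m = Poly_Mapping.single 7 1 + m'"
      by (rule xvar_mult_keys)
    then show ?thesis using J5_keys[OF uv(2)]
      by (auto simp: x_def lookup_add lookup_single)
  qed
qed

lemma Idl_dvd:
  assumes "g \<in> S" "g dvd p"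
  shows "p \<in> Idl\<^bsub>Q7\<^esub> S"
proof -
  interpret cring Q7 by (rule cring_Q7)
  have "g \<in> Idl\<^bsub>Q7\<^esub> S" using genideal_self[of S] assms(1) by auto
  moreover obtain r where "p = r * g" using assms(2) by (auto simp: dvd_def mult.commute)
  moreover have "ideal (Idl\<^bsub>Q7\<^esub> S) Q7" by (rule genideal_ideal) simp
  ultimately show ?thesis unfolding ideal_Q7_iff by blast
qed

lemma L5_edge:
  assumes "(u, v) \<in> {(1, 2), (2, 3), (3, 4), (4, 5), (5, 1)}"
  shows "xvar 6 * (xvar u * xvar v) \<in> L5"
proof -
  have "xvar u * xvar v \<in> I5"
    unfolding I5_def by (rule Idl_dvd[OF _ dvd_refl]) (use assms in auto)
  moreover have "0 \<in> J5" using ideal_J5 by (simp add: ideal_Q7_iff)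
  ultimately show ?thesis unfolding L5_iff by force
qed

text \<open>The triples are the minimal vertex covers of the 5-cycle, two neighbours and the vertex
  opposite to them. Each meets every edge, so the product lies in all five primes.\<close>

lemma L5_cover:
  assumes "(u, v, w) \<in> {(1, 2, 4), (2, 3, 5), (3, 4, 1), (4, 5, 2), (5, 1, 3)}"
  shows "xvar 7 * (xvar u * xvar v * xvar w) \<in> L5"
proof -
  have *: "p \<in> Idl\<^bsub>Q7\<^esub> {xvar i, xvar j}" if "xvar i dvd p \<or> xvar j dvd p" for i j p
    using that by (auto intro: Idl_dvd[of "xvar i"] Idl_dvd[of "xvar j"])
  have "xvar u * xvar v * xvar w \<in> J5"
    unfolding J5_def using assms by (auto intro!: * simp: dvd_mult dvd_mult2)
  moreover have "0 \<in> I5" using ideal_I5 by (simp add: ideal_Q7_iff)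
  ultimately show ?thesis unfolding L5_iff by force
qed

section \<open>Splitting generators off lattice points of the Newton polyhedra\<close>

definition xmono :: "int \<Rightarrow> int \<Rightarrow> int \<Rightarrow> int \<Rightarrow> int \<Rightarrow> int \<Rightarrow> int \<Rightarrow> qpoly7"
  where "xmono r s a b c d e = xvar 6 ^ nat r * xvar 7 ^ nat s *
    (xvar 1 ^ nat a * xvar 2 ^ nat b * xvar 3 ^ nat c * xvar 4 ^ nat d * xvar 5 ^ nat e)"

lemma single_eq_xmono:
  fixes m :: "7 \<Rightarrow>\<^sub>0 nat"
  defines "x \<equiv> \<lambda>v. int (Poly_Mapping.lookup m v)"
  shows "Poly_Mapping.single m 1 = xmono (x 6) (x 7) (x 1) (x 2) (x 3) (x 4) (x 5)"
proof -
  have xvar_power: "xvar v ^ n = Poly_Mapping.single (Poly_Mapping.single v n) 1" for v n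
    by (induction n) (simp_all add: xvar_def mult_single flip: single_add)
  let ?y = "\<lambda>v. Poly_Mapping.single v (Poly_Mapping.lookup m v)"
  have "m = ?y 6 + ?y 7 + (?y 1 + ?y 2 + ?y 3 + ?y 4 + ?y 5)"
  proof (rule poly_mapping_eqI)
    fix v
    show "Poly_Mapping.lookup m v = Poly_Mapping.lookup (?y 6 + ?y 7 + (?y 1 + ?y 2 + ?y 3 + ?y 4 + ?y 5)) v"
      using exhaust_7[of v] by (auto simp: lookup_add lookup_single)
  qed
  then have "Poly_Mapping.single m (1::rat) =
      Poly_Mapping.single (?y 6 + ?y 7 + (?y 1 + ?y 2 + ?y 3 + ?y 4 + ?y 5)) 1"
    by (rule arg_cong)
  then show ?thesis
    by (simp only: xmono_def x_def xvar_power mult_single nat_int mult_1)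
qed

text \<open>
  The facet inequalities of \<open>r NP(I\<^sub>5) + s NP(J\<^sub>5)\<close>, where \<open>NP\<close> denotes the Newton polyhedron: the
  coefficients of \<open>r\<close> and \<open>s\<close> are the minima of the weight on \<open>I\<^sub>5\<close> and on \<open>J\<^sub>5\<close>.
\<close>

definition mixed :: "int \<Rightarrow> int \<Rightarrow> int \<Rightarrow> int \<Rightarrow> int \<Rightarrow> int \<Rightarrow> int \<Rightarrow> bool" where
  "mixed r s a b c d e \<longleftrightarrow>
     0 \<le> a \<and> 0 \<le> b \<and> 0 \<le> c \<and> 0 \<le> d \<and> 0 \<le> e \<and>
     s \<le> a + b \<and> s \<le> b + c \<and> s \<le> c + d \<and> s \<le> d + e \<and> s \<le> e + a \<and>
     r + s \<le> a + b + d \<and> r + s \<le> b + c + e \<and> r + s \<le> c + d + a \<and> r + s \<le> d + e + b \<and> r + s \<le> e + a + c \<and>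
     r + 2 * s \<le> b + c + d + e \<and> r + 2 * s \<le> a + c + d + e \<and> r + 2 * s \<le> a + b + d + e \<and>
     r + 2 * s \<le> a + b + c + e \<and> r + 2 * s \<le> a + b + c + d \<and>
     2 * r + 3 * s \<le> a + b + c + d + e"

text \<open>Assuming \<open>r \<noteq> 1\<close> keeps out the all-ones point at
  \<open>r = s = 1\<close>: there each cover leaves two non-adjacent vertices, hence no
  edge.\<close>

lemma mixed_cover:
  assumes "mixed r s a b c d e" "1 \<le> s" "0 \<le> r" "r \<noteq> 1"
  shows "mixed r (s - 1) (a - 1) (b - 1) c (d - 1) e \<or> mixed r (s - 1) a (b - 1) (c - 1) d (e - 1) \<or>
    mixed r (s - 1) (a - 1) b (c - 1) (d - 1) e \<or> mixed r (s - 1) a (b - 1) c (d - 1) (e - 1) \<or>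
    mixed r (s - 1) (a - 1) b (c - 1) d (e - 1)"
  using assms unfolding mixed_def by (smt (z3))

text \<open>Treats what \<open>mixed_cover\<close> leaves, apart from \<open>r = s = 1\<close>: only
  edges remain (\<open>s = 0\<close>), or a single edge with at least two covers.\<close>

lemma mixed_edge:
  assumes "mixed r s a b c d e" "1 \<le> r" "r = 1 \<or> s = 0" "0 \<le> s" "s \<noteq> 1"
  shows "mixed (r - 1) s (a - 1) (b - 1) c d e \<or> mixed (r - 1) s a (b - 1) (c - 1) d e \<or>
    mixed (r - 1) s a b (c - 1) (d - 1) e \<or> mixed (r - 1) s a b c (d - 1) (e - 1) \<or>
    mixed (r - 1) s (a - 1) b c d (e - 1)"
  using assms unfolding mixed_def by (smt (z3))

text \<open>Integer exponents avoid truncated subtraction, so \<open>mixed\<close> can reject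
  negative ones; this lemma returns to honest powers.\<close>

lemma power_nat_pred:
  fixes x :: "'a::monoid_mult"
  assumes "1 \<le> z"
  shows "x ^ nat z = x ^ nat (z - 1) * x"
proof -
  have "nat z = Suc (nat (z - 1))" using assms by simp
  then show ?thesis by (simp only: power_Suc2)
qed

text \<open>
  To keep away from \<open>r = s = 1\<close>, covers are split off first if \<open>r \<noteq> 1\<close>, whereas an edge is split off
  first if \<open>r = 1\<close>.
\<close>

lemma xmono_mem:
  assumes "mixed r s a b c d e" "0 \<le> r" "0 \<le> s" "\<not> (r = 1 \<and> s = 1)" "r + s = int n"
  shows "xmono r s a b c d e \<in> ideal_pow Q7 L5 n"
  using assms
proof (induction n arbitrary: r s a b c d e)
  case (Suc n)
  have step: "p \<in> ideal_pow Q7 L5 (Suc n)"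
    if "q \<in> ideal_pow Q7 L5 n" "g \<in> L5" "p = q * g" for p q g
    using ideal_prod.prod[of q "ideal_pow Q7 L5 n" g L5 Q7] that by simp
  show ?case
  proof (cases "1 \<le> s \<and> r \<noteq> 1")
    case True
    have *: "xmono r s a b c d e \<in> ideal_pow Q7 L5 (Suc n)"
      if "mixed r (s - 1) a' b' c' d' e'"
        and "xmono r s a b c d e = xmono r (s - 1) a' b' c' d' e' * (xvar 7 * (xvar u * xvar v * xvar w))"
        and "(u, v, w) \<in> {(1, 2, 4), (2, 3, 5), (3, 4, 1), (4, 5, 2), (5, 1, 3)}"
      for a' b' c' d' e' u v w
      by (rule step[OF Suc.IH[OF that(1)] L5_cover[OF that(3)] that(2)]) (use Suc.prems True in auto)
    note pred = power_nat_pred[of s] power_nat_pred[of a] power_nat_pred[of b] power_nat_pred[of c]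
      power_nat_pred[of d] power_nat_pred[of e]
    have "mixed r (s - 1) (a - 1) (b - 1) c (d - 1) e \<or> mixed r (s - 1) a (b - 1) (c - 1) d (e - 1) \<or>
      mixed r (s - 1) (a - 1) b (c - 1) (d - 1) e \<or> mixed r (s - 1) a (b - 1) c (d - 1) (e - 1) \<or>
      mixed r (s - 1) (a - 1) b (c - 1) d (e - 1)"
      using mixed_cover[OF Suc.prems(1)] Suc.prems True by blast
    then show ?thesis
    proof (elim disjE)
      assume m: "mixed r (s - 1) (a - 1) (b - 1) c (d - 1) e"
      \<comment> \<open>Nonnegativity of the lowered exponents, part of \<open>mixed\<close>, says
        that the cover divides the monomial.\<close>
      then have "1 \<le> a" "1 \<le> b" "1 \<le> d" by (simp_all add: mixed_def)
      with m True show ?thesis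
        by (intro *[of "a - 1" "b - 1" c "d - 1" e 1 2 4]) (simp_all add: xmono_def pred mult_ac)
    next
      assume m: "mixed r (s - 1) a (b - 1) (c - 1) d (e - 1)"
      then have "1 \<le> b" "1 \<le> c" "1 \<le> e" by (simp_all add: mixed_def)
      with m True show ?thesis
        by (intro *[of a "b - 1" "c - 1" d "e - 1" 2 3 5]) (simp_all add: xmono_def pred mult_ac)
    next
      assume m: "mixed r (s - 1) (a - 1) b (c - 1) (d - 1) e"
      then have "1 \<le> a" "1 \<le> c" "1 \<le> d" by (simp_all add: mixed_def)
      with m True show ?thesis
        by (intro *[of "a - 1" b "c - 1" "d - 1" e 3 4 1]) (simp_all add: xmono_def pred mult_ac)
    next
      assume m: "mixed r (s - 1) a (b - 1) c (d - 1) (e - 1)"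
      then have "1 \<le> b" "1 \<le> d" "1 \<le> e" by (simp_all add: mixed_def)
      with m True show ?thesis
        by (intro *[of a "b - 1" c "d - 1" "e - 1" 4 5 2]) (simp_all add: xmono_def pred mult_ac)
    next
      assume m: "mixed r (s - 1) (a - 1) b (c - 1) d (e - 1)"
      then have "1 \<le> a" "1 \<le> c" "1 \<le> e" by (simp_all add: mixed_def)
      with m True show ?thesis
        by (intro *[of "a - 1" b "c - 1" d "e - 1" 5 1 3]) (simp_all add: xmono_def pred mult_ac)
    qed
  next
    case False
    \<comment> \<open>Removing an edge now leads to \<open>r = 0\<close> or keeps
      \<open>s = 0\<close>, so the induction never meets \<open>r = s = 1\<close>.\<close>
    then have rs: "1 \<le> r" "r = 1 \<or> s = 0" "s \<noteq> 1" using Suc.prems by auto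
    have *: "xmono r s a b c d e \<in> ideal_pow Q7 L5 (Suc n)"
      if "mixed (r - 1) s a' b' c' d' e'"
        and "xmono r s a b c d e = xmono (r - 1) s a' b' c' d' e' * (xvar 6 * (xvar u * xvar v))"
        and "(u, v) \<in> {(1, 2), (2, 3), (3, 4), (4, 5), (5, 1)}"
      for a' b' c' d' e' u v
      by (rule step[OF Suc.IH[OF that(1)] L5_edge[OF that(3)] that(2)]) (use Suc.prems rs in auto)
    note pred = power_nat_pred[of r] power_nat_pred[of a] power_nat_pred[of b] power_nat_pred[of c]
      power_nat_pred[of d] power_nat_pred[of e]
    have "mixed (r - 1) s (a - 1) (b - 1) c d e \<or> mixed (r - 1) s a (b - 1) (c - 1) d e \<or>
      mixed (r - 1) s a b (c - 1) (d - 1) e \<or> mixed (r - 1) s a b c (d - 1) (e - 1) \<or>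
      mixed (r - 1) s (a - 1) b c d (e - 1)"
      using mixed_edge[OF Suc.prems(1)] Suc.prems rs by blast
    then show ?thesis
    proof (elim disjE)
      assume m: "mixed (r - 1) s (a - 1) (b - 1) c d e"
      then have "1 \<le> a" "1 \<le> b" by (simp_all add: mixed_def)
      with m rs(1) show ?thesis
        by (intro *[of "a - 1" "b - 1" c d e 1 2]) (simp_all add: xmono_def pred mult_ac)
    next
      assume m: "mixed (r - 1) s a (b - 1) (c - 1) d e"
      then have "1 \<le> b" "1 \<le> c" by (simp_all add: mixed_def)
      with m rs(1) show ?thesis
        by (intro *[of a "b - 1" "c - 1" d e 2 3]) (simp_all add: xmono_def pred mult_ac)
    next
      assume m: "mixed (r - 1) s a b (c - 1) (d - 1) e"
      then have "1 \<le> c" "1 \<le> d" by (simp_all add: mixed_def)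
      with m rs(1) show ?thesis
        by (intro *[of a b "c - 1" "d - 1" e 3 4]) (simp_all add: xmono_def pred mult_ac)
    next
      assume m: "mixed (r - 1) s a b c (d - 1) (e - 1)"
      then have "1 \<le> d" "1 \<le> e" by (simp_all add: mixed_def)
      with m rs(1) show ?thesis
        by (intro *[of a b c "d - 1" "e - 1" 4 5]) (simp_all add: xmono_def pred mult_ac)
    next
      assume m: "mixed (r - 1) s (a - 1) b c d (e - 1)"
      then have "1 \<le> a" "1 \<le> e" by (simp_all add: mixed_def)
      with m rs(1) show ?thesis
        by (intro *[of "a - 1" b c d "e - 1" 5 1]) (simp_all add: xmono_def pred mult_ac)
    qed
  qed
qed simp

text \<open>
  All weights needed have coefficients \<open>0\<close> and \<open>1\<close> and are given by the list of their variables;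
  their minimum on \<open>L\<^sub>5\<close> is \<open>1\<close>, respectively \<open>2\<close>. The remaining one is \<open>[1, 2, 3, 4, 5, 6]\<close>, with
  minimum \<open>3\<close>.
\<close>

definition weight1 :: "7 list set" where
  "weight1 = {[6, 7], [1, 2, 4], [2, 3, 5], [3, 4, 1], [4, 5, 2], [5, 1, 3],
    [1, 2, 6], [2, 3, 6], [3, 4, 6], [4, 5, 6], [5, 1, 6]}"

definition weight2 :: "7 list set" where
  "weight2 = {[1, 2, 3, 4, 5], [2, 3, 4, 5, 6], [1, 3, 4, 5, 6], [1, 2, 4, 5, 6], [1, 2, 3, 5, 6],
    [1, 2, 3, 4, 6]}"

section \<open>From weight bounds to membership in powers of \<open>L5\<close>\<close>

lemma single_mem_ideal_pow_L5:
  fixes m :: "7 \<Rightarrow>\<^sub>0 nat" and i :: nat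
  defines "x \<equiv> Poly_Mapping.lookup m"
  assumes i: "i \<ge> 3"
    and weight1: "\<And>vs. vs \<in> weight1 \<Longrightarrow> i \<le> sum_list (map x vs)"
    and weight2: "\<And>vs. vs \<in> weight2 \<Longrightarrow> 2 * i \<le> sum_list (map x vs)"
    and weight3: "3 * i \<le> sum_list (map x [1, 2, 3, 4, 5, 6])"
  shows "Poly_Mapping.single m 1 \<in> ideal_pow Q7 L5 i"
proof -
  interpret cring Q7 by (rule cring_Q7)
  have "\<forall>vs\<in>weight1. i \<le> sum_list (map x vs)" "\<forall>vs\<in>weight2. 2 * i \<le> sum_list (map x vs)"
    using weight1 weight2 by blast+
  note bounds = this[unfolded weight1_def weight2_def ball_simps list.map sum_list.Cons sum_list.Nil]
    weight3[unfolded list.map sum_list.Cons sum_list.Nil]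
  \<comment> \<open>As many of the \<open>i\<close> factors as possible use \<open>xvar 6\<close>;
    the weight \<open>[6, 7]\<close> then gives \<open>s \<le> x 7\<close>.\<close>
  define r where "r = min (x 6) i"
  define s where "s = i - r"
  have rs: "r + s = i" "r \<le> x 6" "s \<le> x 7"
    using bounds(1) by (auto simp: r_def s_def)
  have "mixed r s (x 1) (x 2) (x 3) (x 4) (x 5)"
  proof (cases "i \<le> x 6")
    case True
    then have "r = i" "s = 0" by (auto simp: r_def s_def)
    then show ?thesis unfolding mixed_def using bounds by linarith
  next
    case False
    \<comment> \<open>Here \<open>r\<close> is the full exponent of \<open>xvar 6\<close>:
      subtracting it from the weights that involve this variable gives inequalities of
      \<open>mixed\<close>.\<close>
    then have "int (x 6) = r" "int i = r + s" using rs by (auto simp: r_def)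
    then show ?thesis unfolding mixed_def using bounds by linarith
  qed
  \<comment> \<open>The exceptional pair \<open>r = s = 1\<close> would force
    \<open>i = 2\<close>.\<close>
  then have mem: "xmono r s (x 1) (x 2) (x 3) (x 4) (x 5) \<in> ideal_pow Q7 L5 i"
    by (rule xmono_mem) (use rs i in auto)
  have "Poly_Mapping.single m 1 = xvar 6 ^ (x 6 - r) * xvar 7 ^ (x 7 - s) * xmono r s (x 1) (x 2) (x 3) (x 4) (x 5)"
  proof -
    have "xvar 6 ^ x 6 = xvar 6 ^ (x 6 - r) * xvar 6 ^ r" "xvar 7 ^ x 7 = xvar 7 ^ (x 7 - s) * xvar 7 ^ s"
      using rs by (simp_all flip: power_add)
    then show ?thesis
      unfolding single_eq_xmono xmono_def x_def[symmetric] nat_int by (simp only: mult_ac)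
  qed
  then show ?thesis
    using mem ideal_ideal_pow[OF ideal_L5, of i] by (simp add: ideal_Q7_iff)
qed

text \<open>Coefficients are constant polynomials, so \<open>I\<close> contains each term of
  \<open>f\<close> along with its monomial.\<close>

lemma monomials_mem_ideal:
  assumes I: "ideal I Q7" and f: "\<And>m. m \<in> Poly_Mapping.keys f \<Longrightarrow> Poly_Mapping.single m 1 \<in> I"
  shows "f \<in> I"
proof -
  have sum_mem: "sum h A \<in> I" if "\<And>m. m \<in> A \<Longrightarrow> h m \<in> I" for h :: "(7 \<Rightarrow>\<^sub>0 nat) \<Rightarrow> qpoly7" and A
    using that I by (induction A rule: infinite_finite_induct) (auto simp: ideal_Q7_iff)
  have "Poly_Mapping.single m (Poly_Mapping.lookup f m) \<in> I" if "m \<in> Poly_Mapping.keys f" for m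
  proof -
    have "Poly_Mapping.single 0 (Poly_Mapping.lookup f m) * Poly_Mapping.single m 1 \<in> I"
      using I f[OF that] by (simp add: ideal_Q7_iff)
    then show ?thesis by (simp add: mult_single)
  qed
  then have "(\<Sum>m\<in>Poly_Mapping.keys f. Poly_Mapping.single m (Poly_Mapping.lookup f m)) \<in> I"
    by (rule sum_mem)
  moreover have "(\<Sum>m\<in>Poly_Mapping.keys f. Poly_Mapping.single m (Poly_Mapping.lookup f m)) = f"
    by (rule poly_mapping_eqI) (simp add: lookup_sum lookup_single when_def in_keys_iff)
  ultimately show ?thesis by simp
qed

theorem theorem4p4:
  fixes i :: nat
  assumes "i \<ge> 3"
  shows "integrally_closed Q7 (ideal_pow Q7 L5 i)"
proof -
  interpret cring Q7 by (rule cring_Q7)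
  have L: "ideal (ideal_pow Q7 L5 i) Q7"
    by (rule ideal_ideal_pow[OF ideal_L5])
  have "f \<in> ideal_pow Q7 L5 i" if f: "f \<in> integral_closure Q7 (ideal_pow Q7 L5 i)" for f
  proof (rule monomials_mem_ideal[OF L])
    fix m assume m: "m \<in> Poly_Mapping.keys f"
    let ?x = "Poly_Mapping.lookup m"
    have bound: "d * i \<le> \<phi> m"
      if "weight \<phi>" "\<And>g n. g \<in> L5 \<Longrightarrow> n \<in> Poly_Mapping.keys g \<Longrightarrow> d \<le> \<phi> n" for \<phi> d
    proof -
      have "L5 \<subseteq> weight_ge \<phi> d" using that(2) by (auto simp: weight_ge_def)
      from integral_closure_weight_ge[OF that(1) this f] m show ?thesis
        by (auto simp: weight_ge_def mult.commute)
    qed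
    have weight_sum: "weight (\<lambda>n. sum_list (map (Poly_Mapping.lookup n) vs))" for vs :: "7 list"
      by unfold_locales (induction vs, simp_all add: lookup_add)
    have bound_list: "d * i \<le> sum_list (map ?x vs)"
      if "\<And>g n. g \<in> L5 \<Longrightarrow> n \<in> Poly_Mapping.keys g \<Longrightarrow> d \<le> sum_list (map (Poly_Mapping.lookup n) vs)" for vs d
      using bound[OF weight_sum, of d vs] that by blast
    \<comment> \<open>It remains to bound each weight from below on the two kinds of monomials of
      \<open>L5\<close>.\<close>
    have "1 * i \<le> sum_list (map ?x vs)" if "vs \<in> weight1" for vs
    proof (rule bound_list)
      fix g n assume "g \<in> L5" "n \<in> Poly_Mapping.keys g"
      from L5_keys[OF this] that show "1 \<le> sum_list (map (Poly_Mapping.lookup n) vs)"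
        by (auto simp: weight1_def)
    qed
    moreover have "2 * i \<le> sum_list (map ?x vs)" if "vs \<in> weight2" for vs
    proof (rule bound_list)
      fix g n assume "g \<in> L5" "n \<in> Poly_Mapping.keys g"
      from L5_keys[OF this] that show "2 \<le> sum_list (map (Poly_Mapping.lookup n) vs)"
        by (auto simp: weight2_def)
    qed
    moreover have "3 * i \<le> sum_list (map ?x [1, 2, 3, 4, 5, 6])"
    proof (rule bound_list)
      fix g n assume "g \<in> L5" "n \<in> Poly_Mapping.keys g"
      from L5_keys[OF this] show "3 \<le> sum_list (map (Poly_Mapping.lookup n) [1, 2, 3, 4, 5, 6])" by auto
    qed
    ultimately show "Poly_Mapping.single m 1 \<in> ideal_pow Q7 L5 i"
      using single_mem_ideal_pow_L5[OF assms, of m] by (simp only: mult_1)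
  qed
  then show ?thesis
    unfolding integrally_closed_def using subset_integral_closure[OF L] by blast
qed

end
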